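(* For all real parameters $a>0$ and $b>0$, the planar vector field $F:\mathbb{R}^2\to\mathbb{R}^2$, $$F(x,y)=\Big((a-x)(1+x^2)-4xy,\; b x\,(1+x^2-y)\Big),$$ is not bounded.
   Context: A planar vector field is said to be bounded if the forward orbit of every initial condition in $\mathbb{R}^2$ enters and remains in a compact set. Orbits are those of the differential system $(\dot x,\dot y)=F(x,y)$, considered on their maximal intervals of definition (solutions may not be defined for all forward time). *)

theory Defs
  imports "HOL-Analysis.Analysis"
begin

definition solution_on ::
  "(real \<times> real \<Rightarrow> real \<times> real) \<Rightarrow> real \<times> real \<Rightarrow> real set \<Rightarrow> (real \<Rightarrow> real \<times> real) \<Rightarrow> bool"
where
  "solution_on F p J u \<longleftrightarrow>
     open J \<and> is_interval J \<and> 0 \<in> J \<and> u 0 = p \<and>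
     (\<forall>t\<in>J. (u has_vector_derivative F (u t)) (at t))"

(* Values of u outside J are irrelevant, so extensions are compared on J only. *)
definition maximal_solution_on ::
  "(real \<times> real \<Rightarrow> real \<times> real) \<Rightarrow> real \<times> real \<Rightarrow> real set \<Rightarrow> (real \<Rightarrow> real \<times> real) \<Rightarrow> bool"
where
  "maximal_solution_on F p J u \<longleftrightarrow>
     solution_on F p J u \<and>
     (\<forall>J' u'. solution_on F p J' u' \<and> J \<subseteq> J' \<and> (\<forall>t\<in>J. u' t = u t) \<longrightarrow> J' = J)"

(* The compact set may depend on the initial condition. The forward orbit is taken over the
   whole nonnegative part of the maximal interval J, so an orbit that blows up in finite
   forward time violates the condition. *)
definition bounded_vector_field :: "(real \<times> real \<Rightarrow> real \<times> real) \<Rightarrow> bool"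
where
  "bounded_vector_field F \<longleftrightarrow>
     (\<forall>p J u. maximal_solution_on F p J u \<longrightarrow>
        (\<exists>K. compact K \<and> (\<exists>t0\<in>J. t0 \<ge> 0 \<and> (\<forall>t\<in>J. t \<ge> t0 \<longrightarrow> u t \<in> K))))"

end

theory Submission imports Defs begin

text \<open>Follow the orbit of \<open>(-2, -(a + 2))\<close>. The quadrant \<open>x < -1, y < -(a + 1)\<close> is forward
  invariant, and inside it \<open>y' \<le> -b\<close>, so an orbit defined for all forward time has
  \<open>y \<rightarrow> -\<infinity>\<close>. If instead the maximal interval has a finite right end point, the orbit cannot
  stay in a compact set, since it could then be continued. A maximal solution is obtained from a
  local one by Zorn's lemma applied to the graphs of solutions; uniqueness plays no role.\<close>

text \<open>Lipschitz functions are bounded on a bounded set, and with bounds for both factors the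
  difference of two products splits into two Lipschitz terms. This carries the Lipschitz property
  from the coordinates to polynomials.\<close>

lemma lipschitz_on_mult_bounded:
  fixes f g :: "'a::heine_borel \<Rightarrow> real"
  assumes "\<exists>L. L-lipschitz_on S f" "\<exists>L. L-lipschitz_on S g" "bounded S"
  shows "\<exists>L. L-lipschitz_on S (\<lambda>x. f x * g x)"
proof -
  obtain L M where L: "L-lipschitz_on S f" and M: "M-lipschitz_on S g" using assms by blast
  have bnd: "bounded (f ` S)" "bounded (g ` S)"
    using L M assms(3) lipschitz_on_uniformly_continuous bounded_uniformly_continuous_image by blast+
  obtain A where A: "\<And>x. x \<in> S \<Longrightarrow> \<bar>f x\<bar> \<le> A" "A > 0"
    using bnd(1) unfolding bounded_pos by auto
  obtain B where B: "\<And>x. x \<in> S \<Longrightarrow> \<bar>g x\<bar> \<le> B" "B > 0"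
    using bnd(2) unfolding bounded_pos by auto
  have "(A * M + B * L)-lipschitz_on S (\<lambda>x. f x * g x)"
  proof (rule lipschitz_onI)
    fix x y assume xy: "x \<in> S" "y \<in> S"
    have "f x * g x - f y * g y = f x * (g x - g y) + g y * (f x - f y)"
      by (simp add: algebra_simps)
    then have "\<bar>f x * g x - f y * g y\<bar> \<le> \<bar>f x\<bar> * \<bar>g x - g y\<bar> + \<bar>g y\<bar> * \<bar>f x - f y\<bar>"
      by (metis abs_mult abs_triangle_ineq)
    also have "\<dots> \<le> A * (M * dist x y) + B * (L * dist x y)"
      using A B xy lipschitz_onD[OF L xy] lipschitz_onD[OF M xy]
      by (intro add_mono mult_mono) (auto simp: dist_real_def)
    finally show "dist (f x * g x) (f y * g y) \<le> (A * M + B * L) * dist x y"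
      by (simp add: dist_real_def algebra_simps)
  next
    show "0 \<le> A * M + B * L"
      using A(2) B(2) lipschitz_on_nonneg[OF L] lipschitz_on_nonneg[OF M] by simp
  qed
  then show ?thesis by blast
qed

section \<open>Local existence of solutions\<close>

text \<open>Picard iteration takes place on bounded continuous functions on the whole line: the
  integral is made constant outside \<open>[-d, d]\<close>.\<close>
lemma picard_lipschitz:
  fixes G :: "'a::banach \<Rightarrow> 'a"
  assumes "L-lipschitz_on UNIV G"
  obtains d u where "d > 0" "u 0 = p" "continuous_on UNIV u"
    "\<And>t. t \<in> {-d<..<d} \<Longrightarrow> (u has_vector_derivative G (u t)) (at t)"
proof -
  have L0: "L \<ge> 0" using assms by (rule lipschitz_on_nonneg)
  have contG: "continuous_on UNIV G" using assms by (rule lipschitz_on_continuous_on)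
  \<comment> \<open>The interval \<open>{-d..d}\<close> has length \<open>2 * d\<close>, and
    \<open>L * (2 * d) \<le> 1/4\<close>. The Picard map contains two such integrals, so it
    contracts by the factor \<open>1/2\<close>. Using \<open>L + 1\<close> keeps the quotient
    meaningful when \<open>L = 0\<close>.\<close>
  define d where "d = 1 / (8 * (L + 1))"
  have d: "d > 0" using L0 by (simp add: d_def)
  define c where "c = (\<lambda>t. max (-d) (min d t))"
  have c_in: "c t \<in> {-d..d}" for t using d by (auto simp: c_def)
  have c_cont: "continuous_on UNIV c" unfolding c_def by (intro continuous_intros)
  \<comment> \<open>Integrating from \<open>-d\<close> covers both time directions with one ordinary
    integral; subtracting \<open>I \<phi> 0\<close> in \<open>P\<close> moves the base point to time
    0.\<close>
  define I where "I = (\<lambda>\<phi> t. integral {-d..t} (\<lambda>s. G (apply_bcontfun \<phi> s)))"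
  define P where "P = (\<lambda>\<phi> t. p + I \<phi> (c t) - I \<phi> 0)"
  have contGphi: "continuous_on S (\<lambda>s. G (apply_bcontfun \<phi> s))" for S :: "real set" and \<phi>
    by (rule continuous_on_compose2[OF contG]) auto
  have I_cont: "continuous_on {-d..d} (I \<phi>)" for \<phi>
    unfolding I_def by (intro indefinite_integral_continuous_1 integrable_continuous_real contGphi)
  have P_cont: "continuous_on UNIV (P \<phi>)" for \<phi>
    unfolding P_def
    by (intro continuous_intros continuous_on_compose2[OF I_cont c_cont]) (use c_in in auto)
  have P_bcont: "P \<phi> \<in> bcontfun" for \<phi>
  proof -
    have "compact ((\<lambda>s. p + I \<phi> s - I \<phi> 0) ` {-d..d})"
      by (intro compact_continuous_image continuous_intros I_cont) auto
    then have "bounded ((\<lambda>s. p + I \<phi> s - I \<phi> 0) ` {-d..d})"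
      by (rule compact_imp_bounded)
    moreover have "range (P \<phi>) \<subseteq> (\<lambda>s. p + I \<phi> s - I \<phi> 0) ` {-d..d}"
      using c_in by (auto simp: P_def)
    ultimately show ?thesis
      using P_cont by (auto simp: bcontfun_def intro: bounded_subset)
  qed
  have I_dist: "norm (I \<phi> t - I \<psi> t) \<le> 1/4 * dist \<phi> \<psi>" if t: "t \<in> {-d..d}" for \<phi> \<psi> t
  proof -
    have "I \<phi> t - I \<psi> t = integral {-d..t} (\<lambda>s. G (apply_bcontfun \<phi> s) - G (apply_bcontfun \<psi> s))"
      unfolding I_def
      by (intro Henstock_Kurzweil_Integration.integral_diff[symmetric]
          integrable_continuous_real contGphi)
    also have "norm \<dots> \<le> (L * dist \<phi> \<psi>) * (t - (- d))"
    proof (rule integral_bound)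
      fix s
      have "norm (G (apply_bcontfun \<phi> s) - G (apply_bcontfun \<psi> s)) \<le>
          L * dist (apply_bcontfun \<phi> s) (apply_bcontfun \<psi> s)"
        using lipschitz_onD[OF assms] by (metis UNIV_I dist_norm)
      also have "\<dots> \<le> L * dist \<phi> \<psi>"
        by (intro mult_left_mono dist_bounded L0)
      finally show "norm (G (apply_bcontfun \<phi> s) - G (apply_bcontfun \<psi> s)) \<le> L * dist \<phi> \<psi>" .
    qed (use t in \<open>auto intro!: continuous_intros contGphi\<close>)
    also have "\<dots> \<le> (L * dist \<phi> \<psi>) * (2 * d)"
      using t L0 by (intro mult_left_mono) auto
    also have "\<dots> = (L * (2 * d)) * dist \<phi> \<psi>" by simp
    also have "\<dots> \<le> 1/4 * dist \<phi> \<psi>"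
      using L0 by (intro mult_right_mono) (auto simp: d_def field_simps)
    finally show ?thesis .
  qed
  have "\<exists>!\<phi>. Bcontfun (P \<phi>) = \<phi>"
  proof (rule banach_fix_type)
    show "\<forall>\<phi> \<psi>. dist (Bcontfun (P \<phi>)) (Bcontfun (P \<psi>)) \<le> 1/2 * dist \<phi> \<psi>"
    proof (intro allI dist_bound)
      fix \<phi> \<psi> t
      have "P \<phi> t - P \<psi> t = (I \<phi> (c t) - I \<psi> (c t)) - (I \<phi> 0 - I \<psi> 0)"
        by (simp add: P_def)
      then have "norm (P \<phi> t - P \<psi> t) \<le> norm (I \<phi> (c t) - I \<psi> (c t)) + norm (I \<phi> 0 - I \<psi> 0)"
        by (metis norm_triangle_ineq4)
      also have "\<dots> \<le> 1/4 * dist \<phi> \<psi> + 1/4 * dist \<phi> \<psi>"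
        using d by (intro add_mono I_dist c_in) auto
      finally show "dist (apply_bcontfun (Bcontfun (P \<phi>)) t) (apply_bcontfun (Bcontfun (P \<psi>)) t)
          \<le> 1/2 * dist \<phi> \<psi>"
        by (simp add: Bcontfun_inverse P_bcont dist_norm)
    qed
  qed auto
  then obtain \<phi> where "Bcontfun (P \<phi>) = \<phi>" by blast
  then have fix_eq: "apply_bcontfun \<phi> t = P \<phi> t" for t
    by (metis Bcontfun_inverse P_bcont)
  have "(apply_bcontfun \<phi> has_vector_derivative G (apply_bcontfun \<phi> t)) (at t)"
    if t: "t \<in> {-d<..<d}" for t
  proof -
    have "(I \<phi> has_vector_derivative G (apply_bcontfun \<phi> t)) (at t within {-d..d})"
      unfolding I_def using t by (intro integral_has_vector_derivative contGphi) auto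
    then have "(I \<phi> has_vector_derivative G (apply_bcontfun \<phi> t)) (at t)"
      using t by (simp add: at_within_Icc_at)
    \<comment> \<open>On the open interval the clamp \<open>c\<close> is the identity, so there the
      fixed point is \<open>I \<phi>\<close> plus a constant.\<close>
    then have "((\<lambda>s. I \<phi> s + (p - I \<phi> 0)) has_vector_derivative G (apply_bcontfun \<phi> t)) (at t)"
      by (simp only: has_vector_derivative_add_const)
    then show ?thesis
      by (rule has_vector_derivative_transform_within_open[of _ _ _ "{-d<..<d}"])
        (use t in \<open>auto simp: fix_eq P_def c_def\<close>)
  qed
  moreover have "apply_bcontfun \<phi> 0 = p"
    using d by (simp add: fix_eq P_def c_def)
  ultimately show ?thesis
    using that[OF d, of "apply_bcontfun \<phi>"] by simp
qed

text \<open>On the plane this amounts to local Lipschitz continuity, since closed balls are compact.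
  Balls are used because they are convex, so that the nearest-point map onto them is
  1-Lipschitz.\<close>

definition lipschitz_on_cballs :: "('a::metric_space \<Rightarrow> 'b::metric_space) \<Rightarrow> bool" where
  "lipschitz_on_cballs F \<longleftrightarrow> (\<forall>p r. \<exists>L. L-lipschitz_on (cball p r) F)"

lemma lipschitz_on_cballs_continuous:
  assumes "lipschitz_on_cballs F"
  shows "continuous_on S F"
proof -
  have "isCont F x" for x
  proof -
    obtain L where "L-lipschitz_on (cball x 1) F"
      using assms unfolding lipschitz_on_cballs_def by blast
    then have "continuous_on (ball x 1) F"
      by (meson ball_subset_cball continuous_on_subset lipschitz_on_continuous_on)
    then show ?thesis
      by (simp add: continuous_on_eq_continuous_at)
  qed
  then show ?thesis
    by (simp add: continuous_at_imp_continuous_on)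
qed

lemma local_solution:
  assumes "lipschitz_on_cballs F"
  obtains d u where "d > 0" "solution_on F p {-d<..<d} u"
proof -
  obtain L where L: "L-lipschitz_on (cball p 1) F"
    using assms unfolding lipschitz_on_cballs_def by blast
  \<comment> \<open>The nearest-point retraction turns \<open>F\<close> into a globally Lipschitz field \<open>F \<circ> C\<close> that agrees
    with it near \<open>p\<close>.\<close>
  define C where "C = closest_point (cball p 1)"
  have C_in: "C x \<in> cball p 1" for x
    unfolding C_def by (rule closest_point_in_set) auto
  have "1-lipschitz_on UNIV C"
    unfolding C_def by (rule lipschitz_onI) (auto intro!: closest_point_lipschitz)
  moreover have "L-lipschitz_on (C ` UNIV) F"
    using L by (rule lipschitz_on_subset) (use C_in in auto)
  ultimately have "(L * 1)-lipschitz_on UNIV (F \<circ> C)"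
    by (rule lipschitz_on_compose)
  then obtain d u where d: "d > 0" and u0: "u 0 = p" and u_cont: "continuous_on UNIV u"
    and u: "\<And>t. t \<in> {-d<..<d} \<Longrightarrow> (u has_vector_derivative (F \<circ> C) (u t)) (at t)"
    by (rule picard_lipschitz[of _ _ p]) blast
  \<comment> \<open>For short times the solution stays in the ball, where \<open>C\<close> is the
    identity, and hence it solves the original equation.\<close>
  have "isCont u 0" using u_cont by (simp add: continuous_on_eq_continuous_at)
  then obtain e where e: "e > 0" "\<And>t. dist t 0 < e \<Longrightarrow> dist (u t) p < 1"
    unfolding continuous_at_eps_delta u0 by (metis zero_less_one)
  have "solution_on F p {- min d e<..<min d e} u"
    unfolding solution_on_def
  proof (intro conjI ballI)
    fix t assume t: "t \<in> {- min d e<..<min d e}"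
    then have "dist t 0 < e" by (auto simp: dist_real_def)
    then have "u t \<in> cball p 1" using e(2)[of t] by (simp add: dist_commute)
    then have "C (u t) = u t" unfolding C_def by (rule closest_point_self)
    then show "(u has_vector_derivative F (u t)) (at t)" using u[of t] t by auto
  qed (use d e u0 in \<open>auto simp: is_interval_oo\<close>)
  with that[of "min d e"] d e show ?thesis by simp
qed

section \<open>Maximal solutions\<close>

lemma maximal_solution_exists:
  assumes "solution_on F p J0 u0"
  obtains J u where "maximal_solution_on F p J u"
proof -
  \<comment> \<open>Inclusion of graphs over \<open>J\<close> is exactly extension of solutions.
    Values outside \<open>J\<close> are forgotten, so functions that differ only there give the same
    element of the ordered family.\<close>
  define gr where "gr = (\<lambda>J (u :: real \<Rightarrow> real \<times> real). (\<lambda>t. (t, u t)) ` J)"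
  define A where "A = {gr J u | J u. solution_on F p J u}"
  have gr_subset: "gr J u \<subseteq> gr J' u' \<longleftrightarrow> J \<subseteq> J' \<and> (\<forall>t\<in>J. u' t = u t)" for J u J' u'
    by (auto simp: gr_def)
  have "\<exists>M\<in>A. \<forall>X\<in>A. M \<subseteq> X \<longrightarrow> X = M"
  proof (rule subset_Zorn_nonempty)
    show "A \<noteq> {}" using assms by (auto simp: A_def)
    fix \<C> assume ne: "\<C> \<noteq> {}" and chain: "subset.chain A \<C>"
    define S where "S = {(J, u). solution_on F p J u \<and> gr J u \<in> \<C>}"
    have \<C>_eq: "\<C> = (\<lambda>(J, u). gr J u) ` S"
      using chain by (force simp: subset.chain_def A_def S_def)
    have sol: "solution_on F p J u" if "(J, u) \<in> S" for J u
      using that by (simp add: S_def)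
    \<comment> \<open>Graphs in a chain are comparable, so two of its solutions agree wherever both
      are defined. This makes the description in \<open>w\<close> below well defined.\<close>
    have agree: "u t = u' t" if "(J, u) \<in> S" "(J', u') \<in> S" "t \<in> J" "t \<in> J'" for J u J' u' t
    proof -
      have "gr J u \<subseteq> gr J' u' \<or> gr J' u' \<subseteq> gr J u"
        using chain that by (auto simp: subset.chain_def S_def)
      with that show ?thesis unfolding gr_subset by metis
    qed
    define K where "K = (\<Union>(J, u)\<in>S. J)"
    define w where "w = (\<lambda>t. THE y. \<exists>(J, u)\<in>S. t \<in> J \<and> y = u t)"
    have w: "w t = u t" if "(J, u) \<in> S" "t \<in> J" for J u t
      unfolding w_def
    proof (rule the_equality)
      show "\<exists>(J, u')\<in>S. t \<in> J \<and> u t = u' t" using that by auto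
      show "y = u t" if "\<exists>(J, u)\<in>S. t \<in> J \<and> y = u t" for y
        using that agree \<open>(J, u) \<in> S\<close> \<open>t \<in> J\<close> by auto
    qed
    have "S \<noteq> {}" using ne \<C>_eq by auto
    then obtain J1 u1 where S1: "(J1, u1) \<in> S" by auto
    have "solution_on F p K w"
      unfolding solution_on_def
    proof (intro conjI ballI)
      show "open K" using sol by (auto simp: K_def solution_on_def)
      have "connected K"
        unfolding K_def
      proof (rule connected_Union)
        show "connected s" if "s \<in> (\<lambda>(J, u). J) ` S" for s
          using that sol by (auto simp: solution_on_def is_interval_connected_1)
        have "0 \<in> \<Inter> ((\<lambda>(J, u). J) ` S)"
          using sol by (auto simp: solution_on_def)
        then show "\<Inter> ((\<lambda>(J, u). J) ` S) \<noteq> {}" by blast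
      qed
      then show "is_interval K" by (simp add: is_interval_connected_1)
      show "0 \<in> K" "w 0 = p"
        using S1 sol[OF S1] w[OF S1, of 0] by (auto simp: K_def solution_on_def)
      fix t assume "t \<in> K"
      then obtain J u where Ju: "(J, u) \<in> S" "t \<in> J" by (auto simp: K_def)
      have "open J" "(u has_vector_derivative F (u t)) (at t)"
        using sol[OF Ju(1)] Ju(2) by (auto simp: solution_on_def)
      then have "(w has_vector_derivative F (u t)) (at t)"
        using has_vector_derivative_transform_within_open[of u _ t J w] Ju w[OF Ju(1)] by simp
      then show "(w has_vector_derivative F (w t)) (at t)" using w[OF Ju] by simp
    qed
    moreover have "gr K w = \<Union>\<C>"
    proof -
      have "gr K w = (\<Union>(J, u)\<in>S. gr J w)" by (auto simp: gr_def K_def)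
      also have "\<dots> = (\<Union>(J, u)\<in>S. gr J u)"
        using w by (intro SUP_cong) (auto simp: gr_def)
      finally show ?thesis by (simp add: \<C>_eq)
    qed
    ultimately show "\<Union>\<C> \<in> A" unfolding A_def by (auto intro!: exI[of _ K] exI[of _ w])
  qed
  then obtain M0 where M0: "M0 \<in> A" "\<forall>X\<in>A. M0 \<subseteq> X \<longrightarrow> X = M0" by (elim bexE)
  obtain J u where Ju: "M0 = gr J u" and sol: "solution_on F p J u"
    using M0(1) unfolding A_def by auto
  have "maximal_solution_on F p J u"
    unfolding maximal_solution_on_def
  proof (intro conjI allI impI sol, elim conjE)
    fix J' u' assume *: "solution_on F p J' u'" "J \<subseteq> J'" "\<forall>t\<in>J. u' t = u t"
    then have "M0 \<subseteq> gr J' u'" by (simp add: gr_subset Ju)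
    moreover have "gr J' u' \<in> A" using * by (auto simp: A_def)
    ultimately have "gr J' u' = gr J u" using M0(2) Ju by simp
    then have "gr J' u' \<subseteq> gr J u" by simp
    with * show "J' = J" by (simp add: gr_subset)
  qed
  then show ?thesis by (rule that)
qed

section \<open>Continuation past a finite right end point\<close>

lemma has_vector_derivative_norm_bound:
  fixes u :: "real \<Rightarrow> 'a::banach"
  assumes "s \<le> t" "\<And>r. r \<in> {s..t} \<Longrightarrow> (u has_vector_derivative u' r) (at r)"
    and "continuous_on {s..t} u'" "\<And>r. r \<in> {s..t} \<Longrightarrow> norm (u' r) \<le> M"
  shows "norm (u t - u s) \<le> M * (t - s)"
proof -
  have "(u' has_integral (u t - u s)) {s..t}"
    using assms(1,2)
    by (intro fundamental_theorem_of_calculus) (auto intro: has_vector_derivative_at_within)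
  then have "u t - u s = integral {s..t} u'" by (simp add: integral_unique)
  with integral_bound[OF assms(1,3,4)] show ?thesis by simp
qed

text \<open>A bounded solution is Lipschitz in time, hence has a limit at a finite right end point
  of its interval, and a local solution through the limit extends it.\<close>
lemma maximal_solution_in_compact_not_bdd_above:
  assumes max: "maximal_solution_on F p J u" and F: "lipschitz_on_cballs F"
    and K: "compact K" and t0: "t0 \<in> J" and uK: "\<And>t. t \<in> J \<Longrightarrow> t \<ge> t0 \<Longrightarrow> u t \<in> K"
  shows "\<not> bdd_above J"
proof
  assume bdd: "bdd_above J"
  have J: "open J" "is_interval J" "0 \<in> J" "u 0 = p"
    and du: "\<And>t. t \<in> J \<Longrightarrow> (u has_vector_derivative F (u t)) (at t)"
    using max by (auto simp: maximal_solution_on_def solution_on_def)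
  have F_cont: "continuous_on S F" for S by (rule lipschitz_on_cballs_continuous[OF F])
  define T where "T = Sup J"
  have le_T: "t \<le> T" if "t \<in> J" for t using that bdd by (simp add: T_def cSup_upper)
  have T_notin: "T \<notin> J"
  proof
    assume "T \<in> J"
    then obtain e where "e > 0" "ball T e \<subseteq> J" using J(1) open_contains_ball by metis
    then have "T + e/2 \<in> J" by (auto simp: dist_real_def subset_iff)
    then show False using le_T[of "T + e/2"] \<open>e > 0\<close> by simp
  qed
  have lt_T: "t < T" if "t \<in> J" for t using le_T[OF that] that T_notin by (cases "t = T") auto
  have in_J: "t \<in> J" if "t0 \<le> t" "t < T" for t
  proof -
    obtain s where "s \<in> J" "t < s"
      using \<open>t < T\<close> t0 unfolding T_def by (metis empty_iff less_cSupD)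
    then show ?thesis using \<open>t0 \<le> t\<close> t0 J(2) by (meson less_imp_le mem_is_interval_1_I)
  qed
  have t0T: "t0 < T" by (rule lt_T[OF t0])
  have "bounded (F ` K)"
    using K F_cont by (intro compact_imp_bounded compact_continuous_image)
  then obtain M where M: "M > 0" "\<And>x. x \<in> K \<Longrightarrow> norm (F x) \<le> M"
    unfolding bounded_pos by auto
  have u_cont: "continuous_on J u"
    using du by (intro continuous_at_imp_continuous_on)
      (auto intro: has_vector_derivative_continuous)
  have u_lip: "norm (u t - u s) \<le> M * (t - s)" if "t0 \<le> s" "s \<le> t" "t < T" for s t
  proof (rule has_vector_derivative_norm_bound[OF that(2)])
    have sub: "{s..t} \<subseteq> J" using that in_J by auto
    show "continuous_on {s..t} (\<lambda>r. F (u r))"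
      using continuous_on_compose2[OF F_cont[of UNIV] continuous_on_subset[OF u_cont sub]] by auto
    fix r assume r: "r \<in> {s..t}"
    then have "r \<in> J" "t0 \<le> r" using sub that by auto
    then show "(u has_vector_derivative F (u r)) (at r)" "norm (F (u r)) \<le> M"
      using du M(2) uK by blast+
  qed
  have "M-lipschitz_on {t0..<T} u"
  proof (rule lipschitz_onI)
    fix s t assume st: "s \<in> {t0..<T}" "t \<in> {t0..<T}"
    show "dist (u s) (u t) \<le> M * dist s t"
    proof (cases "s \<le> t")
      case True
      then show ?thesis using u_lip[of s t] st by (simp add: dist_norm norm_minus_commute)
    next
      case False
      then show ?thesis using u_lip[of t s] st by (simp add: dist_norm)
    qed
  qed (use M in simp)
  then have "uniformly_continuous_on {t0..<T} u"
    by (rule lipschitz_on_uniformly_continuous)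
  \<comment> \<open>By completeness \<open>u\<close> extends continuously to \<open>T\<close>; the
    value \<open>g T\<close> is the left limit of the orbit.\<close>
  then obtain g where "uniformly_continuous_on (closure {t0..<T}) g"
    and gu: "\<And>t. t \<in> {t0..<T} \<Longrightarrow> u t = g t"
    by (rule uniformly_continuous_on_extension_on_closure) blast
  then have g_cont: "continuous_on {t0..T} g"
    using t0T by (auto intro: uniformly_continuous_imp_continuous)
  have Fg_cont: "continuous_on {t0..T} (\<lambda>t. F (g t))"
    by (rule continuous_on_compose2[OF F_cont[of UNIV] g_cont]) auto
  \<comment> \<open>The interior form of the fundamental theorem asks for the derivative only inside
    the interval, so the integral equation holds up to \<open>T\<close>. Differentiating it in
    \<open>g_der\<close> yields the one-sided derivative at \<open>T\<close>.\<close>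
  have g_int: "g t = g t0 + integral {t0..t} (\<lambda>s. F (g s))" if t: "t \<in> {t0..T}" for t
  proof -
    have "((\<lambda>s. F (g s)) has_integral (g t - g t0)) {t0..t}"
    proof (rule fundamental_theorem_of_calculus_interior)
      show "continuous_on {t0..t} g"
        using g_cont by (rule continuous_on_subset) (use t in auto)
      fix s assume s: "s \<in> {t0<..<t}"
      then have "s \<in> J" using t in_J by auto
      then have "(u has_vector_derivative F (g s)) (at s)" using du gu s t by fastforce
      then show "(g has_vector_derivative F (g s)) (at s)"
        by (rule has_vector_derivative_transform_within_open[of _ _ _ "{t0<..<T}"])
          (use s t gu in auto)
    qed (use t in auto)
    then show ?thesis by (simp add: integral_unique)
  qed
  have g_der: "(g has_vector_derivative F (g T)) (at T within {t0..T})"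
  proof -
    have "((\<lambda>t. integral {t0..t} (\<lambda>s. F (g s))) has_vector_derivative F (g T))
        (at T within {t0..T})"
      using t0T by (intro integral_has_vector_derivative Fg_cont) auto
    then have "((\<lambda>t. integral {t0..t} (\<lambda>s. F (g s)) + g t0) has_vector_derivative F (g T))
        (at T within {t0..T})"
      by (simp only: has_vector_derivative_add_const)
    moreover have "g t = integral {t0..t} (\<lambda>s. F (g s)) + g t0" if "t \<in> {t0..T}" for t
      using g_int[OF that] by (metis add.commute)
    moreover have "T \<in> {t0..T}" using t0T by simp
    ultimately show ?thesis
      using has_vector_derivative_transform[of T "{t0..T}" g
          "\<lambda>t. integral {t0..t} (\<lambda>s. F (g s)) + g t0" "F (g T)"] by blast
  qed
  obtain d v where d: "d > 0" and v: "solution_on F (g T) {-d<..<d} v"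
    by (rule local_solution[OF F])
  have v0: "v 0 = g T" using v by (simp add: solution_on_def)
  \<comment> \<open>The field is autonomous, so shifting the local solution in time gives a solution
    that passes through \<open>g T\<close> at time \<open>T\<close>.\<close>
  define vT where "vT = (\<lambda>t. v (t - T))"
  have vT: "(vT has_vector_derivative F (vT t)) (at t)" if "t \<in> {T-d<..<T+d}" for t
  proof -
    have "(v has_vector_derivative F (v (t - T))) (at (t - T))"
      using v that by (auto simp: solution_on_def)
    then have "((v \<circ> (\<lambda>t. t - T)) has_vector_derivative 1 *\<^sub>R F (v (t - T))) (at t)"
      by (intro vector_diff_chain_at) (auto intro!: derivative_eq_intros)
    then show ?thesis by (simp add: vT_def o_def)
  qed
  define w where "w = (\<lambda>t. if t < T then u t else vT t)"
  \<comment> \<open>Since \<open>{t0<..<T}\<close> already lies in \<open>J\<close>, only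
    \<open>{T..<T+d}\<close> is new. Starting at \<open>t0\<close> gives an overlap with
    \<open>J\<close>, which makes the union connected.\<close>
  define J' where "J' = J \<union> {t0<..<T+d}"
  have "(w has_vector_derivative F (w t)) (at t)" if t: "t \<in> J'" for t
  proof -
    consider "t < T" | "t = T" | "t > T" by linarith
    then show ?thesis
    proof cases
      case 1
      then have "t \<in> J" using t in_J by (auto simp: J'_def)
      from du[OF this] show ?thesis
        using has_vector_derivative_transform_within_open[of u _ t "{..<T}" w] 1
        by (simp add: w_def)
    next
      case 3
      then have "(vT has_vector_derivative F (vT t)) (at t)"
        using vT t lt_T by (force simp: J'_def)
      then show ?thesis
        using has_vector_derivative_transform_within_open[of vT _ t "{T<..}" w] 3
        by (simp add: w_def)
    next
      case 2
      \<comment> \<open>At the junction, the left derivative of \<open>g\<close> and the right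
        derivative of \<open>vT\<close> are both \<open>F (g T)\<close>, and the two closed pieces
        meet only at \<open>T\<close>.\<close>
      have cl: "closure {t0..T} \<inter> closure {T..T+d/2} = {T}" using t0T d by auto
      have T2: "vT T = g T" by (simp add: vT_def v0)
      have "((\<lambda>t. if t \<in> {t0..T} then g t else vT t) has_vector_derivative
          (if T \<in> {t0..T} then F (g T) else F (g T))) (at T within {t0..T+d/2})"
      proof (rule has_vector_derivative_If_within_closures[where T = "{T..T+d/2}"])
        show "(g has_vector_derivative F (g T))
            (at T within {t0..T} \<union> (closure {t0..T} \<inter> closure {T..T+d/2}))"
          unfolding cl using g_der t0T by (simp add: insert_absorb)
        show "(vT has_vector_derivative F (g T))
            (at T within {T..T+d/2} \<union> (closure {t0..T} \<inter> closure {T..T+d/2}))"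
          using vT[of T] d T2 by (auto intro: has_vector_derivative_at_within)
      qed (use t0T d T2 in auto)
      then have "((\<lambda>t. if t \<in> {t0..T} then g t else vT t) has_vector_derivative F (g T)) (at T)"
        using t0T d by (simp add: at_within_Icc_at)
      then have "(w has_vector_derivative F (g T)) (at T)"
        by (rule has_vector_derivative_transform_within_open[of _ _ _ "{t0<..<T+d}"])
          (use t0T d gu T2 in \<open>auto simp: w_def\<close>)
      then show ?thesis using 2 T2 by (simp add: w_def)
    qed
  qed
  moreover have "is_interval J'"
  proof -
    have "(t0 + T) / 2 \<in> J \<inter> {t0<..<T+d}" using in_J[of "(t0+T)/2"] t0T d by auto
    then have "connected J'" unfolding J'_def
      using J(2) by (intro connected_Un) (auto simp: is_interval_connected_1)
    then show ?thesis by (simp add: is_interval_connected_1)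
  qed
  ultimately have "solution_on F p J' w"
    using J lt_T[OF J(3)] by (auto simp: solution_on_def J'_def w_def)
  moreover have "\<forall>t\<in>J. w t = u t" using lt_T by (simp add: w_def)
  ultimately have "J' = J"
    using max by (auto simp: maximal_solution_on_def J'_def)
  moreover have "T \<in> J'" using t0T d by (simp add: J'_def)
  ultimately show False using T_notin by simp
qed

section \<open>The unbounded orbit of the given field\<close>

text \<open>The quadrant \<open>x \<le> -1, y \<le> -(a + 1)\<close> is forward invariant: there \<open>y\<close> decreases, and on
  the side \<open>x = -1\<close> the first component of the field is \<open>2 (a + 1) + 4 y < 0\<close>.\<close>
lemma quadrant_forward_invariant:
  fixes a b :: real and x y :: "real \<Rightarrow> real"
  assumes ab: "a > 0" "b > 0" and t1: "t1 \<ge> 0" and init: "x 0 < -1" "y 0 < - (a + 1)"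
    and dx: "\<And>t. t \<in> {0..t1} \<Longrightarrow>
      (x has_real_derivative (a - x t) * (1 + (x t)^2) - 4 * x t * y t) (at t)"
    and dy: "\<And>t. t \<in> {0..t1} \<Longrightarrow>
      (y has_real_derivative b * x t * (1 + (x t)^2 - y t)) (at t)"
  shows "x t1 < -1 \<and> y t1 < - (a + 1)"
proof (rule ccontr)
  assume neg: "\<not> ?thesis"
  \<comment> \<open>\<open>B\<close> collects the times outside the open quadrant. It is closed, so
    its infimum is attained and is the first exit time.\<close>
  define B where "B = {t \<in> {0..t1}. x t \<ge> -1} \<union> {t \<in> {0..t1}. y t \<ge> - (a + 1)}"
  have cont: "continuous_on {0..t1} x" "continuous_on {0..t1} y"
    using DERIV_isCont[OF dx] DERIV_isCont[OF dy]
    by (blast intro: continuous_at_imp_continuous_on)+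
  have "closed B"
    unfolding B_def using cont
    by (intro closed_Un continuous_on_closed_Collect_le continuous_on_const) auto
  moreover have B_ne: "t1 \<in> B" using neg t1 by (auto simp: B_def)
  moreover have bdd: "bdd_below B" by (auto simp: B_def bdd_below_def intro!: exI[of _ 0])
  ultimately have sB: "Inf B \<in> B" by (intro closed_contains_Inf) auto
  define s where "s = Inf B"
  have s: "s \<in> {0..t1}" using sB by (auto simp: B_def s_def)
  have "s \<noteq> 0" using sB init by (auto simp: B_def s_def)
  then have s_pos: "s > 0" using s by auto
  have before: "x t < -1" "y t < - (a + 1)" if "0 \<le> t" "t < s" for t
  proof -
    have "t \<notin> B" using that bdd by (metis cInf_lower not_le s_def)
    then show "x t < -1" "y t < - (a + 1)" using that s by (auto simp: B_def)
  qed
  \<comment> \<open>Before the exit \<open>x\<close> is negative and \<open>1 + x^2 - y\<close>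
    positive, so \<open>y\<close> decreases. The exit must therefore occur through the side
    \<open>x = -1\<close>.\<close>
  have "y s < y 0"
  proof (rule DERIV_neg_imp_decreasing_open[OF s_pos])
    fix t assume t: "0 < t" "t < s"
    have "b * x t < 0"
      using before[of t] t ab by (simp add: mult_pos_neg)
    moreover have "0 < 1 + (x t)^2 - y t"
      using before[of t] t ab zero_le_power2[of "x t"] by linarith
    ultimately have "b * x t * (1 + (x t)^2 - y t) < 0" by (simp add: mult_neg_pos)
    with dy[of t] t s show "\<exists>l. (y has_real_derivative l) (at t) \<and> l < 0" by auto
  qed (use cont(2) s in \<open>auto intro: continuous_on_subset\<close>)
  then have ys: "y s < - (a + 1)" using init by simp
  then have "x s \<ge> -1" using sB by (auto simp: B_def s_def)
  moreover have "x s \<le> -1"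
  proof (rule ccontr)
    assume "\<not> x s \<le> -1"
    \<comment> \<open>The value is the midpoint of \<open>-1\<close> and \<open>x s\<close>; it
      would be taken strictly before \<open>s\<close>, where \<open>x\<close> is still below
      \<open>-1\<close>.\<close>
    then have "\<exists>t\<ge>0. t \<le> s \<and> x t = (x s - 1) / 2"
      using init s
      by (intro IVT') (auto intro: continuous_on_subset[OF cont(1)])
    then obtain t where t: "0 \<le> t" "t \<le> s" "x t = (x s - 1) / 2" by blast
    then have "t < s" using \<open>\<not> x s \<le> -1\<close> by (cases "t = s") auto
    then show False using before[of t] t \<open>\<not> x s \<le> -1\<close> by simp
  qed
  ultimately have xs: "x s = -1" by simp
  have "(x has_real_derivative (a + 1) * 2 + 4 * y s) (at s)"
    using dx[OF s] by (simp add: xs algebra_simps)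
  moreover have "(a + 1) * 2 + 4 * y s < 0" using ys ab by (simp add: algebra_simps)
  \<comment> \<open>A negative derivative at \<open>s\<close> puts \<open>x\<close> above
    \<open>-1\<close> just before \<open>s\<close>, against \<open>before\<close>. The cap by
    \<open>s\<close> in \<open>h\<close> keeps \<open>s - h\<close> nonnegative.\<close>
  ultimately obtain e where e: "e > 0" "\<And>h. h > 0 \<Longrightarrow> h < e \<Longrightarrow> x s < x (s - h)"
    using DERIV_neg_dec_left by blast
  define h where "h = min (e / 2) s"
  have "h > 0" "h < e" "0 \<le> s - h" "s - h < s" using e s_pos by (auto simp: h_def)
  then show False using e(2)[of h] before(1)[of "s - h"] xs by simp
qed

text \<open>Both components are polynomials, hence built from constants and the two projections by
  operations that preserve the Lipschitz property on bounded sets.\<close>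

lemma lipschitz_on_cballs_field:
  fixes a b :: real
  shows "lipschitz_on_cballs
    (\<lambda>(x, y). ((a - x) * (1 + x^2) - 4 * x * y, b * x * (1 + x^2 - y)))"
  unfolding lipschitz_on_cballs_def
proof (intro allI)
  fix p :: "real \<times> real" and r :: real
  let ?lip = "\<lambda>f :: real \<times> real \<Rightarrow> real. \<exists>L. L-lipschitz_on (cball p r) f"
  have const: "?lip (\<lambda>_. c)" for c
    using lipschitz_on_constant by blast
  have proj: "?lip fst" "?lip snd"
    by (rule exI[of _ 1], rule lipschitz_onI; simp add: dist_fst_le dist_snd_le)+
  have add: "?lip (\<lambda>q. f q + g q)" and diff: "?lip (\<lambda>q. f q - g q)"
    if "?lip f" "?lip g" for f g
    using that lipschitz_on_add lipschitz_on_diff by blast+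
  have mult: "?lip (\<lambda>q. f q * g q)" if "?lip f" "?lip g" for f g
    using that by (rule lipschitz_on_mult_bounded) auto
  have "?lip (\<lambda>q. (a - fst q) * (1 + fst q * fst q) - 4 * fst q * snd q)"
    "?lip (\<lambda>q. b * fst q * (1 + fst q * fst q - snd q))"
    by (intro add diff mult const proj)+
  then show "\<exists>L. L-lipschitz_on (cball p r)
      (\<lambda>(x, y). ((a - x) * (1 + x^2) - 4 * x * y, b * x * (1 + x^2 - y)))"
    unfolding case_prod_unfold power2_eq_square using lipschitz_on_Pair by blast
qed

theorem theorem1:
  fixes a b :: real
  assumes "a > 0" and "b > 0"
  shows "\<not> bounded_vector_field
           (\<lambda>(x, y). ((a - x) * (1 + x^2) - 4 * x * y, b * x * (1 + x^2 - y)))"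
proof
  let ?F = "\<lambda>(x, y). ((a - x) * (1 + x^2) - 4 * x * y, b * x * (1 + x^2 - y))"
  assume "bounded_vector_field ?F"
  moreover define F where "F = ?F"
  ultimately have bounded: "bounded_vector_field F" by simp
  \<comment> \<open>A point strictly inside the invariant quadrant.\<close>
  define p where "p = (-2 :: real, - (a + 2))"
  have F: "lipschitz_on_cballs F" unfolding F_def by (rule lipschitz_on_cballs_field)
  obtain d v where "solution_on F p {-d<..<d} v"
    by (rule local_solution[OF F])
  then obtain J u where max: "maximal_solution_on F p J u"
    by (rule maximal_solution_exists)
  obtain K t0 where K: "compact K" and t0: "t0 \<in> J" "t0 \<ge> 0"
    and uK: "\<And>t. t \<in> J \<Longrightarrow> t \<ge> t0 \<Longrightarrow> u t \<in> K"
    using bounded[unfolded bounded_vector_field_def, rule_format, OF max] by blast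
  have J: "is_interval J" "0 \<in> J" "u 0 = p"
    and du: "\<And>t. t \<in> J \<Longrightarrow> (u has_vector_derivative F (u t)) (at t)"
    using max by (auto simp: maximal_solution_on_def solution_on_def)
  have "\<not> bdd_above J"
    using max F K t0(1) uK by (rule maximal_solution_in_compact_not_bdd_above)
  \<comment> \<open>An interval that contains 0 and is unbounded above contains every nonnegative
    time.\<close>
  then have in_J: "t \<in> J" if "t \<ge> 0" for t
    using that J(1,2) unfolding bdd_above_def by (meson linear mem_is_interval_1_I)
  define x where "x = (\<lambda>t. fst (u t))"
  define y where "y = (\<lambda>t. snd (u t))"
  have dx: "(x has_real_derivative (a - x t) * (1 + (x t)^2) - 4 * x t * y t) (at t)"
    and dy: "(y has_real_derivative b * x t * (1 + (x t)^2 - y t)) (at t)" if "t \<ge> 0" for t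
    using bounded_linear.has_vector_derivative[OF bounded_linear_fst du[OF in_J[OF that]]]
      bounded_linear.has_vector_derivative[OF bounded_linear_snd du[OF in_J[OF that]]]
    by (simp_all add: has_real_derivative_iff_has_vector_derivative x_def y_def F_def case_prod_unfold)
  have quadrant: "x t < -1 \<and> y t < - (a + 1)" if "t \<ge> 0" for t
    using assms that
    by (rule quadrant_forward_invariant[where x = x and y = y])
      (use dx dy in \<open>auto simp: x_def y_def J(3) p_def\<close>)
  have y_le: "y t \<le> y 0 - b * t" if "t \<ge> 0" for t
  proof -
    \<comment> \<open>In the quadrant \<open>- x s\<close> and \<open>1 + (x s)^2 - y s\<close> are
      both at least 1, so \<open>y\<close> falls at rate at least \<open>b\<close>.\<close>
    have "y t + b * t \<le> y 0 + b * 0"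
    proof (rule DERIV_nonpos_imp_nonincreasing[OF that])
      fix s assume s: "0 \<le> s" "s \<le> t"
      have "x s < -1" "1 \<le> 1 + (x s)^2 - y s"
        using quadrant[OF s(1)] assms zero_le_power2[of "x s"] by (simp, linarith)
      then have "1 * 1 \<le> (- x s) * (1 + (x s)^2 - y s)" by (intro mult_mono) auto
      then have "b * 1 \<le> b * ((- x s) * (1 + (x s)^2 - y s))"
        using assms by (intro mult_left_mono) auto
      then have "b * x s * (1 + (x s)^2 - y s) + b \<le> 0" by (simp add: algebra_simps)
      then show "\<exists>l. ((\<lambda>t. y t + b * t) has_real_derivative l) (at s) \<and> l \<le> 0"
        by (intro exI[of _ "b * x s * (1 + (x s)^2 - y s) + b"])
          (auto intro!: derivative_eq_intros dy[OF s(1)])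
    qed
    then show ?thesis by simp
  qed
  obtain M where M: "\<And>q. q \<in> K \<Longrightarrow> norm q \<le> M"
    using compact_imp_bounded[OF K] unfolding bounded_iff by blast
  \<comment> \<open>This time is late enough for \<open>u t\<close> to lie in \<open>K\<close>,
    while \<open>b * t \<ge> \<bar>M\<bar> + \<bar>y 0\<bar> + 1\<close> forces
    \<open>y t \<le> - \<bar>M\<bar> - 1\<close>, beyond the norm bound \<open>M\<close>.\<close>
  define t where "t = max t0 ((\<bar>M\<bar> + \<bar>y 0\<bar> + 1) / b)"
  have "b * ((\<bar>M\<bar> + \<bar>y 0\<bar> + 1) / b) \<le> b * t"
    using assms by (intro mult_left_mono) (auto simp: t_def)
  then have bt: "\<bar>M\<bar> + \<bar>y 0\<bar> + 1 \<le> b * t" using assms by simp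
  have t: "t \<ge> t0" "t \<ge> 0" using t0 by (auto simp: t_def)
  have "\<bar>y t\<bar> \<le> norm (u t)" using norm_snd_le[of "snd (u t)" "fst (u t)"] by (simp add: y_def)
  also have "\<dots> \<le> M" using t in_J uK M by blast
  finally show False using y_le[OF t(2)] bt by linarith
qed

end
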